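(* Let $\mathcal{H}$ be a separable Hilbert space, let $A$ be a bounded linear operator on $\mathcal{H}$, and let $\mathcal{G}=\{g_j\}_{j\ge1}$ be a Bessel sequence in $\mathcal{H}$. Consider the dynamical system $x_{n+1}=Ax_n+w$, $n\ge 0$, with arbitrary initial state $x_0\in\mathcal{H}$ and source term $w\in\mathcal{H}$. Then the source term $w\in\mathcal{H}$ can be recovered from the measurements $\mathcal{D}(x_0,w)=[\langle x_n,g_j\rangle]_{n\in[N],\,j\ge1}$ in a stable way for some $1\le N<\infty$ if and only if $\mathcal{G}=\{g_j\}_{j\ge1}$ is a frame for $\mathcal{H}$.
   Context: Hilbert spaces are complex. A sequence $\{g_j\}_{j\ge1}$ in $\mathcal{H}$ is a Bessel sequence if there is $C<\infty$ with $\sum_{j}|\langle h,g_j\rangle|^2\le C\|h\|^2$ for all $h\in\mathcal{H}$. It is a frame for $\mathcal{H}$ if there are constants $0<c\le C<\infty$ with $c\|h\|^2\le\sum_j|\langle h,g_j\rangle|^2\le C\|h\|^2$ for all $h\in\mathcal{H}$. For $N\ge1$, $[N]=\{0,1,\dots,N-1\}$. The space $\mathcal{B}(\ell^2,\mathbb{C}^N)$ consists of all complex matrices $D=[d_{nj}]_{n\in[N],\,j\ge1}$ with $N$ rows, each row $(d_{n1},d_{n2},\dots)$ belonging to $\ell^2$, endowed with the norm $\|D\|=\sum_{n=0}^{N-1}\big(\sum_{j=1}^\infty|d_{nj}|^2\big)^{1/2}$. Stable recovery (finitely many iterations $N$, sources in $\mathcal{H}$): the source term can be recovered from $\mathcal{D}(x_0,w)=[\langle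 x_n,g_j\rangle]_{n\in[N],\,j\ge1}$ in a stable way if there exists a bounded linear operator $\mathcal{R}:\mathcal{B}(\ell^2,\mathbb{C}^N)\to\mathcal{H}$ such that $\mathcal{R}(\mathcal{D}(x_0,w))=w$ for all $x_0\in\mathcal{H}$ and all $w\in\mathcal{H}$, where $(x_n)$ is the orbit of the system generated by $x_0$ and $w$. *)

theory Defs
  imports "HOL-Analysis.Analysis"
begin

(* Complex inner product spaces. The inner product is linear in its first argument, and the
   complex scalar multiplication extends the real one inherited from real_normed_vector. *)
class complex_inner = real_normed_vector +
  fixes scaleC :: "complex \<Rightarrow> 'a \<Rightarrow> 'a" (infixr \<open>*\<^sub>C\<close> 75)
    and cinner :: "'a \<Rightarrow> 'a \<Rightarrow> complex"
  assumes scaleR_eq_scaleC: "r *\<^sub>R x = complex_of_real r *\<^sub>C x"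
    and scaleC_add_right: "a *\<^sub>C (x + y) = a *\<^sub>C x + a *\<^sub>C y"
    and scaleC_add_left: "(a + b) *\<^sub>C x = a *\<^sub>C x + b *\<^sub>C x"
    and scaleC_scaleC: "a *\<^sub>C b *\<^sub>C x = (a * b) *\<^sub>C x"
    and scaleC_one: "1 *\<^sub>C x = x"
    and cinner_commute: "cinner x y = cnj (cinner y x)"
    and cinner_add_left: "cinner (x + y) z = cinner x z + cinner y z"
    and cinner_scaleC_left: "cinner (a *\<^sub>C x) y = a * cinner x y"
    and cinner_self_nonneg: "0 \<le> Re (cinner x x)"
    and cinner_self_eq_zero_iff: "cinner x x = 0 \<longleftrightarrow> x = 0"
    and norm_eq_sqrt_cinner: "norm x = sqrt (Re (cinner x x))"

class complex_hilbert_space = complex_inner + complete_space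

instantiation complex :: complex_hilbert_space
begin

definition scaleC_complex :: "complex \<Rightarrow> complex \<Rightarrow> complex"
  where "scaleC_complex a x = a * x"

definition cinner_complex :: "complex \<Rightarrow> complex \<Rightarrow> complex"
  where "cinner_complex x y = x * cnj y"

instance
proof
  fix x :: complex
  show "norm x = sqrt (Re (cinner x x))"
    by (simp add: cinner_complex_def cmod_def power2_eq_square)
qed (simp_all add: scaleC_complex_def cinner_complex_def scaleR_conv_of_real algebra_simps)

end

definition bounded_clinear :: "('a::complex_inner \<Rightarrow> 'b::complex_inner) \<Rightarrow> bool"
  where "bounded_clinear T \<longleftrightarrow>
    bounded_linear T \<and> (\<forall>a x. T (a *\<^sub>C x) = a *\<^sub>C T x)"

(* Sequences (g_j), j >= 1, are indexed from 0 here: g j stands for g_{j+1}. Since suminf of a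
   divergent series is unspecified, convergence is part of the upper bound. *)
definition bessel_sequence :: "(nat \<Rightarrow> 'a::complex_inner) \<Rightarrow> bool"
  where "bessel_sequence g \<longleftrightarrow>
    (\<exists>C. \<forall>h. summable (\<lambda>j. (cmod (cinner h (g j)))\<^sup>2) \<and>
      (\<Sum>j. (cmod (cinner h (g j)))\<^sup>2) \<le> C * (norm h)\<^sup>2)"

definition is_frame :: "(nat \<Rightarrow> 'a::complex_inner) \<Rightarrow> bool"
  where "is_frame g \<longleftrightarrow>
    (\<exists>c C. 0 < c \<and> c \<le> C \<and>
      (\<forall>h. summable (\<lambda>j. (cmod (cinner h (g j)))\<^sup>2) \<and>
        c * (norm h)\<^sup>2 \<le> (\<Sum>j. (cmod (cinner h (g j)))\<^sup>2) \<and>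
        (\<Sum>j. (cmod (cinner h (g j)))\<^sup>2) \<le> C * (norm h)\<^sup>2))"

(* The space B(l^2, C^N): matrices with N square-summable rows. A matrix is a function of the
   row n and the column j that vanishes in the rows n >= N, so that distinct elements
   of the set are distinct N-row matrices. *)
definition l2_matrices :: "nat \<Rightarrow> (nat \<Rightarrow> nat \<Rightarrow> complex) set"
  where "l2_matrices N =
    {D. (\<forall>n<N. summable (\<lambda>j. (cmod (D n j))\<^sup>2)) \<and> (\<forall>n\<ge>N. \<forall>j. D n j = 0)}"

definition l2_matrix_norm :: "nat \<Rightarrow> (nat \<Rightarrow> nat \<Rightarrow> complex) \<Rightarrow> real"
  where "l2_matrix_norm N D = (\<Sum>n<N. sqrt (\<Sum>j. (cmod (D n j))\<^sup>2))"

(* Bounded complex-linear operators from B(l^2, C^N) to a complex inner product space;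
   values outside l2_matrices N are irrelevant. *)
definition bounded_clinear_on_l2_matrices ::
    "nat \<Rightarrow> ((nat \<Rightarrow> nat \<Rightarrow> complex) \<Rightarrow> 'a::complex_inner) \<Rightarrow> bool"
  where "bounded_clinear_on_l2_matrices N R \<longleftrightarrow>
    (\<forall>D\<in>l2_matrices N. \<forall>E\<in>l2_matrices N. R (\<lambda>n j. D n j + E n j) = R D + R E) \<and>
    (\<forall>a. \<forall>D\<in>l2_matrices N. R (\<lambda>n j. a * D n j) = a *\<^sub>C R D) \<and>
    (\<exists>K. \<forall>D\<in>l2_matrices N. norm (R D) \<le> K * l2_matrix_norm N D)"

primrec orbit :: "('a::complex_inner \<Rightarrow> 'a) \<Rightarrow> 'a \<Rightarrow> 'a \<Rightarrow> nat \<Rightarrow> 'a"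
  where
    "orbit A x0 w 0 = x0"
  | "orbit A x0 w (Suc n) = A (orbit A x0 w n) + w"

definition measurements ::
    "('a::complex_inner \<Rightarrow> 'a) \<Rightarrow> (nat \<Rightarrow> 'a) \<Rightarrow> nat \<Rightarrow> 'a \<Rightarrow> 'a \<Rightarrow> nat \<Rightarrow> nat \<Rightarrow> complex"
  where "measurements A g N x0 w =
    (\<lambda>n j. if n < N then cinner (orbit A x0 w n) (g j) else 0)"

definition stably_recoverable ::
    "('a::complex_inner \<Rightarrow> 'a) \<Rightarrow> (nat \<Rightarrow> 'a) \<Rightarrow> nat \<Rightarrow> bool"
  where "stably_recoverable A g N \<longleftrightarrow>
    (\<exists>R. bounded_clinear_on_l2_matrices N R \<and> (\<forall>x0 w. R (measurements A g N x0 w) = w))"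

end

theory Submission
  imports Defs
begin

text \<open>
  Write \<open>T h = (\<langle>h, g\<^sub>j\<rangle>)\<^sub>j\<close> for the analysis map into \<open>\<ell>\<^sup>2\<close> and \<open>T\<^sup>*\<close> for its adjoint, the synthesis
  map. A Bessel sequence is a frame iff \<open>T\<close> is bounded below.

  For a frame, two time steps suffice: \<open>w = x\<^sub>1 - A x\<^sub>0\<close>, and each state is a bounded function of
  its own measurements through the left inverse \<open>(T\<^sup>* T)\<^sup>-\<^sup>1 T\<^sup>*\<close> of \<open>T\<close>
  (\<open>dual_reconstruction\<close>). The frame operator \<open>T\<^sup>* T\<close> is coercive, so solving
  \<open>T\<^sup>* T h = T\<^sup>* c\<close> is a fixed point problem for the contraction
  \<open>h \<mapsto> h + t (T\<^sup>* c - T\<^sup>* T h)\<close> with small \<open>t > 0\<close>.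

  Conversely, a stable recovery gives \<open>\<parallel>w\<parallel> \<le> K \<Sum>\<^sub>n \<parallel>T x\<^sub>n\<parallel>\<close> for all orbits, and this is tested on
  two orbits. The source \<open>w = h - A h\<close> freezes the orbit at \<open>h\<close>, so \<open>\<parallel>h - A h\<parallel> \<le> K N \<parallel>T h\<parallel>\<close>: a
  vector that is nearly invisible to the sensors is nearly fixed by \<open>A\<close>. The orbit of the zero
  state with source \<open>w = h\<close> is \<open>x\<^sub>n = h + A h + \<dots> + A\<^sup>n\<^sup>-\<^sup>1 h\<close>, which differs from \<open>n h\<close> by at most
  a multiple of \<open>\<parallel>h - A h\<parallel>\<close>; hence each \<open>\<parallel>T x\<^sub>n\<parallel>\<close> is bounded by a multiple of \<open>\<parallel>T h\<parallel>\<close>, and so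
  is \<open>\<parallel>h\<parallel>\<close>.
\<close>

section \<open>Complex inner product spaces\<close>

instance complex_hilbert_space \<subseteq> banach ..

lemma scaleC_minus_one: "(- 1) *\<^sub>C x = - (x::'a::complex_inner)"
  using scaleR_eq_scaleC[of "-1" x] by simp

lemma norm_scaleC: "norm (a *\<^sub>C x) = cmod a * norm (x::'a::complex_inner)"
proof -
  have "cinner (a *\<^sub>C x) (a *\<^sub>C x) = a * cnj a * cinner x x"
    by (metis cinner_scaleC_left cinner_commute complex_cnj_mult mult.assoc)
  also have "\<dots> = complex_of_real ((cmod a)\<^sup>2) * cinner x x"
    by (simp only: complex_norm_square)
  finally show ?thesis
    by (simp add: norm_eq_sqrt_cinner[of "a *\<^sub>C x"] norm_eq_sqrt_cinner[of x] real_sqrt_mult)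
qed

lemma Re_cinner_self: "Re (cinner x x) = (norm (x::'a::complex_inner))\<^sup>2"
  by (simp add: norm_eq_sqrt_cinner cinner_self_nonneg)

lemma Re_cinner_commute: "Re (cinner x y) = Re (cinner y (x::'a::complex_inner))"
  by (metis cinner_commute complex_cnj cnj.simps(1))

lemma cinner_add_right: "cinner x (y + z) = cinner x y + cinner x (z::'a::complex_inner)"
  by (metis cinner_add_left cinner_commute complex_cnj_add)

lemma norm_add_square:
  "(norm (x + y))\<^sup>2 = (norm x)\<^sup>2 + 2 * Re (cinner x y) + (norm (y::'a::complex_inner))\<^sup>2"
  using Re_cinner_commute[of x y]
  by (simp add: Re_cinner_self[symmetric] cinner_add_left cinner_add_right)

text \<open>The triangle inequality is already part of the norm, so expanding \<open>\<parallel>x + y\<parallel>\<^sup>2\<close> bounds the real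
  part; rotating \<open>x\<close> by a unimodular scalar turns the real part into the modulus.\<close>
lemma cmod_cinner_le: "cmod (cinner x y) \<le> norm x * norm (y::'a::complex_inner)"
proof -
  have real_part: "Re (cinner u y) \<le> norm u * norm y" for u :: 'a
  proof -
    have "(norm (u + y))\<^sup>2 \<le> (norm u + norm y)\<^sup>2"
      by (simp add: norm_triangle_ineq power_mono)
    then show ?thesis
      by (simp add: norm_add_square power2_sum)
  qed
  show ?thesis
  proof (cases "cinner x y = 0")
    case False
    define a where "a = cnj (cinner x y) / cmod (cinner x y)"
    have "cmod a = 1"
      using False by (simp add: a_def norm_divide)
    have "a * cinner x y = cmod (cinner x y)"
      using False complex_norm_square[of "cinner x y"]
      by (simp add: a_def power2_eq_square field_simps)
    then have "cmod (cinner x y) = Re (cinner (a *\<^sub>C x) y)"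
      by (simp add: cinner_scaleC_left)
    also have "\<dots> \<le> norm x * norm y"
      using real_part[of "a *\<^sub>C x"] \<open>cmod a = 1\<close> by (simp add: norm_scaleC)
    finally show ?thesis .
  qed simp
qed

lemma bounded_linear_cinner_left: "bounded_linear (\<lambda>x. cinner x (y::'a::complex_inner))"
  by (rule bounded_linear_intro[where K = "norm y"])
     (simp_all add: cinner_add_left scaleR_eq_scaleC scaleC_complex_def
       cinner_scaleC_left cmod_cinner_le)

lemma bounded_linear_scaleC_right: "bounded_linear (\<lambda>x::'a::complex_inner. a *\<^sub>C x)"
  by (rule bounded_linear_intro[where K = "cmod a"])
     (simp_all add: scaleC_add_right scaleR_eq_scaleC scaleC_scaleC norm_scaleC mult.commute)

section \<open>Square-summable sequences\<close>

definition square_summable :: "(nat \<Rightarrow> complex) \<Rightarrow> bool"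
  where "square_summable c \<longleftrightarrow> summable (\<lambda>j. (cmod (c j))\<^sup>2)"

definition l2_norm :: "(nat \<Rightarrow> complex) \<Rightarrow> real"
  where "l2_norm c = sqrt (\<Sum>j. (cmod (c j))\<^sup>2)"

lemma l2_norm_nonneg: "square_summable c \<Longrightarrow> 0 \<le> l2_norm c"
  by (simp add: square_summable_def l2_norm_def suminf_nonneg)

lemma l2_norm_square: "square_summable c \<Longrightarrow> (l2_norm c)\<^sup>2 = (\<Sum>j. (cmod (c j))\<^sup>2)"
  by (simp add: square_summable_def l2_norm_def suminf_nonneg)

lemma L2_set_le_l2_norm:
  assumes "square_summable c" and "finite F"
  shows "L2_set (\<lambda>j. cmod (c j)) F \<le> l2_norm c"
  using assms sum_le_suminf[of "\<lambda>j. (cmod (c j))\<^sup>2" F]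
  by (simp add: square_summable_def l2_norm_def L2_set_def)

text \<open>Bounding all finite sections bounds the whole sequence; this transfers inequalities from
  \<^const>\<open>L2_set\<close>.\<close>
lemma square_summable_l2_norm_leI:
  assumes "\<And>n. L2_set (\<lambda>j. cmod (c j)) {..<n} \<le> M"
  shows "square_summable c" and "l2_norm c \<le> M"
proof -
  have "0 \<le> M"
    using assms[of 0] by simp
  have section_le: "(\<Sum>j<n. (cmod (c j))\<^sup>2) \<le> M\<^sup>2" for n
    using assms[of n] by (simp add: L2_set_def sqrt_le_D)
  show summ: "square_summable c"
    unfolding square_summable_def by (rule summableI_nonneg_bounded) (use section_le in auto)
  have "(\<Sum>j. (cmod (c j))\<^sup>2) \<le> M\<^sup>2"
    using summ section_le by (intro suminf_le_const) (simp_all add: square_summable_def)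
  then show "l2_norm c \<le> M"
    unfolding l2_norm_def using \<open>0 \<le> M\<close> by (simp add: real_le_lsqrt)
qed

lemma l2_add:
  assumes "square_summable c" and "square_summable d"
  shows "square_summable (\<lambda>j. c j + d j)"
    and "l2_norm (\<lambda>j. c j + d j) \<le> l2_norm c + l2_norm d"
proof -
  have "L2_set (\<lambda>j. cmod (c j + d j)) {..<n} \<le> l2_norm c + l2_norm d" for n
  proof -
    have "L2_set (\<lambda>j. cmod (c j + d j)) {..<n}
        \<le> L2_set (\<lambda>j. cmod (c j) + cmod (d j)) {..<n}"
      by (intro L2_set_mono) (auto intro: norm_triangle_ineq)
    also have "\<dots> \<le> L2_set (\<lambda>j. cmod (c j)) {..<n} + L2_set (\<lambda>j. cmod (d j)) {..<n}"
      by (rule L2_set_triangle_ineq)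
    also have "\<dots> \<le> l2_norm c + l2_norm d"
      using assms by (intro add_mono L2_set_le_l2_norm) auto
    finally show ?thesis .
  qed
  then show "square_summable (\<lambda>j. c j + d j)"
    and "l2_norm (\<lambda>j. c j + d j) \<le> l2_norm c + l2_norm d"
    by (rule square_summable_l2_norm_leI)+
qed

lemma l2_scale:
  assumes "square_summable c"
  shows "square_summable (\<lambda>j. a * c j)" and "l2_norm (\<lambda>j. a * c j) = cmod a * l2_norm c"
  using assms
  by (simp_all add: square_summable_def l2_norm_def norm_mult power_mult_distrib
        suminf_mult summable_mult real_sqrt_mult)

section \<open>Analysis and synthesis\<close>

definition analysis :: "(nat \<Rightarrow> 'a::complex_inner) \<Rightarrow> 'a \<Rightarrow> nat \<Rightarrow> complex"
  where "analysis g h = (\<lambda>j. cinner h (g j))"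

definition synthesis :: "(nat \<Rightarrow> 'a::complex_inner) \<Rightarrow> (nat \<Rightarrow> complex) \<Rightarrow> 'a"
  where "synthesis g c = (\<Sum>j. c j *\<^sub>C g j)"

definition bessel_bound :: "(nat \<Rightarrow> 'a::complex_inner) \<Rightarrow> real \<Rightarrow> bool"
  where "bessel_bound g B \<longleftrightarrow> 0 \<le> B \<and>
    (\<forall>h. square_summable (analysis g h) \<and> l2_norm (analysis g h) \<le> B * norm h)"

lemma bessel_sequence_imp_bessel_bound:
  assumes "bessel_sequence g"
  obtains B where "bessel_bound g B"
proof -
  obtain C where C: "\<And>h. summable (\<lambda>j. (cmod (cinner h (g j)))\<^sup>2)"
      "\<And>h. (\<Sum>j. (cmod (cinner h (g j)))\<^sup>2) \<le> C * (norm h)\<^sup>2"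
    using assms unfolding bessel_sequence_def by blast
  have "l2_norm (analysis g h) \<le> sqrt \<bar>C\<bar> * norm h" for h
  proof -
    have "(\<Sum>j. (cmod (cinner h (g j)))\<^sup>2) \<le> \<bar>C\<bar> * (norm h)\<^sup>2"
      using C(2)[of h] by (rule order_trans) (simp add: mult_right_mono)
    then have "l2_norm (analysis g h) \<le> sqrt (\<bar>C\<bar> * (norm h)\<^sup>2)"
      unfolding l2_norm_def analysis_def by (rule real_sqrt_le_mono)
    then show ?thesis
      by (simp add: real_sqrt_mult)
  qed
  then have "bessel_bound g (sqrt \<bar>C\<bar>)"
    using C(1) by (simp add: bessel_bound_def square_summable_def analysis_def)
  then show thesis
    by (rule that)
qed

lemma analysis_add: "analysis g (h + k) = (\<lambda>j. analysis g h j + analysis g k j)"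
  by (simp add: analysis_def cinner_add_left)

lemma analysis_scaleC: "analysis g (a *\<^sub>C h) = (\<lambda>j. a * analysis g h j)"
  by (simp add: analysis_def cinner_scaleC_left)

text \<open>Duality: pairing \<open>y = \<Sum>\<^sub>j c\<^sub>j g\<^sub>j\<close> with itself bounds \<open>\<parallel>y\<parallel>\<^sup>2\<close> by \<open>\<Sum>\<^sub>j \<bar>c\<^sub>j\<bar> \<bar>\<langle>y, g\<^sub>j\<rangle>\<bar>\<close>, and
  Cauchy-Schwarz with the Bessel bound for \<open>y\<close> leaves one factor \<open>\<parallel>y\<parallel>\<close> to cancel.\<close>
lemma norm_finite_synthesis_le:
  assumes "bessel_bound g B" and "finite F"
  shows "norm (\<Sum>j\<in>F. c j *\<^sub>C g j) \<le> B * L2_set (\<lambda>j. cmod (c j)) F"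
proof -
  let ?y = "\<Sum>j\<in>F. c j *\<^sub>C g j"
  let ?l = "L2_set (\<lambda>j. cmod (c j)) F"
  have "cinner ?y ?y = (\<Sum>j\<in>F. c j * cinner (g j) ?y)"
    by (subst linear_sum[OF bounded_linear.linear[OF bounded_linear_cinner_left]])
       (simp add: cinner_scaleC_left)
  then have "(norm ?y)\<^sup>2 \<le> cmod (\<Sum>j\<in>F. c j * cinner (g j) ?y)"
    by (metis Re_cinner_self complex_Re_le_cmod)
  also have "\<dots> \<le> (\<Sum>j\<in>F. \<bar>cmod (c j)\<bar> * \<bar>cmod (analysis g ?y j)\<bar>)"
  proof (rule order_trans[OF norm_sum], rule sum_mono)
    fix j assume "j \<in> F"
    have "cmod (cinner (g j) ?y) = cmod (cinner ?y (g j))"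
      by (metis cinner_commute complex_mod_cnj)
    then show "cmod (c j * cinner (g j) ?y) \<le> \<bar>cmod (c j)\<bar> * \<bar>cmod (analysis g ?y j)\<bar>"
      by (simp add: norm_mult analysis_def)
  qed
  also have "\<dots> \<le> ?l * L2_set (\<lambda>j. cmod (analysis g ?y j)) F"
    by (rule L2_set_mult_ineq)
  also have "\<dots> \<le> ?l * l2_norm (analysis g ?y)"
    using assms by (intro mult_left_mono L2_set_le_l2_norm) (auto simp: bessel_bound_def)
  also have "\<dots> \<le> ?l * (B * norm ?y)"
    using assms by (intro mult_left_mono) (auto simp: bessel_bound_def)
  finally have "norm ?y * norm ?y \<le> (B * ?l) * norm ?y"
    by (simp add: power2_eq_square mult_ac)
  moreover have "0 \<le> B * ?l"
    using assms by (simp add: bessel_bound_def)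
  ultimately show ?thesis
    by (cases "norm ?y = 0") (auto simp: mult_le_cancel_right)
qed

lemma summable_synthesis:
  fixes g :: "nat \<Rightarrow> 'a::complex_hilbert_space"
  assumes g: "bessel_bound g B" and c: "square_summable c"
  shows "summable (\<lambda>j. c j *\<^sub>C g j)"
  unfolding summable_Cauchy
proof (intro allI impI)
  fix e :: real assume "0 < e"
  have "0 \<le> B"
    using g by (simp add: bessel_bound_def)
  define d where "d = (e / (B + 1))\<^sup>2"
  have "0 < d"
    using \<open>0 < e\<close> \<open>0 \<le> B\<close> by (simp add: d_def)
  then obtain N where N: "\<And>m n. N \<le> m \<Longrightarrow> norm (\<Sum>j\<in>{m..<n}. (cmod (c j))\<^sup>2) < d"
    using c unfolding square_summable_def summable_Cauchy by blast
  have "norm (\<Sum>j\<in>{m..<n}. c j *\<^sub>C g j) < e" if "N \<le> m" for m n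
  proof -
    let ?l = "L2_set (\<lambda>j. cmod (c j)) {m..<n}"
    have "(\<Sum>j\<in>{m..<n}. (cmod (c j))\<^sup>2) < d"
      using N[OF that, of n] by simp
    then have "?l < sqrt d"
      unfolding L2_set_def by (rule real_sqrt_less_mono)
    also have "\<dots> = e / (B + 1)"
      using \<open>0 < e\<close> \<open>0 \<le> B\<close> by (simp add: d_def)
    finally have l: "?l * (B + 1) < e"
      using \<open>0 \<le> B\<close> by (simp add: pos_less_divide_eq)
    have "norm (\<Sum>j\<in>{m..<n}. c j *\<^sub>C g j) \<le> B * ?l"
      using g by (rule norm_finite_synthesis_le) simp
    also have "\<dots> \<le> ?l * (B + 1)"
      by (simp add: algebra_simps)
    finally show ?thesis
      using l by simp
  qed
  then show "\<exists>N. \<forall>m\<ge>N. \<forall>n. norm (\<Sum>j\<in>{m..<n}. c j *\<^sub>C g j) < e"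
    by blast
qed

lemma norm_synthesis_le:
  fixes g :: "nat \<Rightarrow> 'a::complex_hilbert_space"
  assumes g: "bessel_bound g B" and c: "square_summable c"
  shows "norm (synthesis g c) \<le> B * l2_norm c"
proof (rule LIMSEQ_le_const2)
  show "(\<lambda>n. norm (\<Sum>j<n. c j *\<^sub>C g j)) \<longlonglongrightarrow> norm (synthesis g c)"
    unfolding synthesis_def by (intro tendsto_norm summable_LIMSEQ summable_synthesis[OF g c])
  have "norm (\<Sum>j<n. c j *\<^sub>C g j) \<le> B * l2_norm c" for n
  proof -
    have "norm (\<Sum>j<n. c j *\<^sub>C g j) \<le> B * L2_set (\<lambda>j. cmod (c j)) {..<n}"
      using g by (rule norm_finite_synthesis_le) simp
    also have "\<dots> \<le> B * l2_norm c"
      using g c by (intro mult_left_mono L2_set_le_l2_norm) (auto simp: bessel_bound_def)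
    finally show ?thesis .
  qed
  then show "\<exists>N. \<forall>n\<ge>N. norm (\<Sum>j<n. c j *\<^sub>C g j) \<le> B * l2_norm c"
    by blast
qed

lemma synthesis_add:
  fixes g :: "nat \<Rightarrow> 'a::complex_hilbert_space"
  assumes "bessel_bound g B" and "square_summable c" and "square_summable d"
  shows "synthesis g (\<lambda>j. c j + d j) = synthesis g c + synthesis g d"
  using suminf_add[OF summable_synthesis[OF assms(1,2)] summable_synthesis[OF assms(1,3)]]
  by (simp add: synthesis_def scaleC_add_left)

lemma synthesis_scale:
  fixes g :: "nat \<Rightarrow> 'a::complex_hilbert_space"
  assumes "bessel_bound g B" and "square_summable c"
  shows "synthesis g (\<lambda>j. a * c j) = a *\<^sub>C synthesis g c"
  using bounded_linear.suminf[OF bounded_linear_scaleC_right summable_synthesis[OF assms], of a]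
  by (simp add: synthesis_def scaleC_scaleC)

section \<open>Inverting the frame operator\<close>

definition frame_operator :: "(nat \<Rightarrow> 'a::complex_inner) \<Rightarrow> 'a \<Rightarrow> 'a"
  where "frame_operator g h = synthesis g (analysis g h)"

lemma frame_operator_add:
  fixes g :: "nat \<Rightarrow> 'a::complex_hilbert_space"
  assumes "bessel_bound g B"
  shows "frame_operator g (h + k) = frame_operator g h + frame_operator g k"
  using assms
  by (simp add: frame_operator_def analysis_add synthesis_add[OF assms] bessel_bound_def)

lemma frame_operator_scaleC:
  fixes g :: "nat \<Rightarrow> 'a::complex_hilbert_space"
  assumes "bessel_bound g B"
  shows "frame_operator g (a *\<^sub>C h) = a *\<^sub>C frame_operator g h"
  using assms
  by (simp add: frame_operator_def analysis_scaleC synthesis_scale[OF assms] bessel_bound_def)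

lemma frame_operator_diff:
  fixes g :: "nat \<Rightarrow> 'a::complex_hilbert_space"
  assumes "bessel_bound g B"
  shows "frame_operator g (h - k) = frame_operator g h - frame_operator g k"
  using frame_operator_add[OF assms, of h "(- 1) *\<^sub>C k"] frame_operator_scaleC[OF assms, of "-1" k]
  by (simp add: scaleC_minus_one)

lemma norm_frame_operator_le:
  fixes g :: "nat \<Rightarrow> 'a::complex_hilbert_space"
  assumes g: "bessel_bound g B"
  shows "norm (frame_operator g h) \<le> B\<^sup>2 * norm h"
proof -
  have "norm (frame_operator g h) \<le> B * l2_norm (analysis g h)"
    unfolding frame_operator_def
    using g by (intro norm_synthesis_le) (auto simp: bessel_bound_def)
  also have "\<dots> \<le> B * (B * norm h)"
    using g by (intro mult_left_mono) (auto simp: bessel_bound_def)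
  finally show ?thesis
    by (simp add: power2_eq_square)
qed

text \<open>Coercivity of the frame operator is the lower frame bound in disguise.\<close>
lemma Re_cinner_frame_operator:
  fixes g :: "nat \<Rightarrow> 'a::complex_hilbert_space"
  assumes g: "bessel_bound g B"
  shows "Re (cinner (frame_operator g h) h) = (l2_norm (analysis g h))\<^sup>2"
proof -
  have ss: "square_summable (analysis g h)"
    using g by (simp add: bessel_bound_def)
  have bl: "bounded_linear (\<lambda>x. Re (cinner x h))"
    by (rule bounded_linear_compose[OF bounded_linear_Re bounded_linear_cinner_left])
  have term_eq: "Re (cinner (analysis g h j *\<^sub>C g j) h) = (cmod (analysis g h j))\<^sup>2" for j
  proof -
    have "cinner (analysis g h j *\<^sub>C g j) h = analysis g h j * cnj (analysis g h j)"
      using cinner_commute[of "g j" h] by (simp add: cinner_scaleC_left analysis_def)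
    then show ?thesis
      by (metis complex_norm_square Re_complex_of_real)
  qed
  show ?thesis
    unfolding frame_operator_def synthesis_def l2_norm_square[OF ss]
    using bounded_linear.suminf[OF bl summable_synthesis[OF g ss]] by (simp add: term_eq)
qed

lemma frame_operator_eq_imp_norm_le:
  fixes g :: "nat \<Rightarrow> 'a::complex_hilbert_space"
  assumes g: "bessel_bound g B" and "0 < m"
    and lower: "\<And>h. m * (norm h)\<^sup>2 \<le> (l2_norm (analysis g h))\<^sup>2"
    and y: "frame_operator g h = y"
  shows "norm h \<le> norm y / m"
proof -
  have "m * (norm h)\<^sup>2 \<le> Re (cinner y h)"
    using lower[of h] Re_cinner_frame_operator[OF g, of h] y by simp
  also have "\<dots> \<le> norm y * norm h"
    using complex_Re_le_cmod cmod_cinner_le order_trans by blast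
  finally have "(m * norm h) * norm h \<le> norm y * norm h"
    by (simp add: power2_eq_square mult_ac)
  then have "m * norm h \<le> norm y"
    by (cases "norm h = 0") (auto simp: mult_le_cancel_right)
  then show ?thesis
    using \<open>0 < m\<close> by (simp add: field_simps)
qed

text \<open>For the step size \<open>t\<close> the map \<open>h \<mapsto> h + t (y - S h)\<close> changes squared distances by a factor of at
  most \<open>1 - 2 t m + t\<^sup>2 B\<^sup>4\<close>, where \<open>m\<close> is the coercivity constant and \<open>B\<^sup>2\<close> bounds \<open>\<parallel>S\<parallel>\<close>. The
  linear term wins for small \<open>t\<close>: if \<open>t B\<^sup>4 \<le> m\<close>, the factor is at most \<open>1 - t m < 1\<close>.\<close>
lemma ex1_frame_operator_eq:
  fixes g :: "nat \<Rightarrow> 'a::complex_hilbert_space"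
  assumes g: "bessel_bound g B" and "0 < m"
    and lower: "\<And>h. m * (norm h)\<^sup>2 \<le> (l2_norm (analysis g h))\<^sup>2"
  shows "\<exists>!h. frame_operator g h = y"
proof -
  let ?S = "frame_operator g"
  \<comment> \<open>The minimiser of the quadratic would be \<open>m / B\<^sup>4\<close>; the slack \<open>m\<^sup>2 + 1\<close> avoids a vanishing
    denominator and keeps the contraction factor nonnegative.\<close>
  define t where "t = m / (B^4 + m\<^sup>2 + 1)"
  define q where "q = 1 - t * m"
  have den: "0 < B^4 + m\<^sup>2 + 1"
    by (simp add: add_nonneg_pos)
  have "0 < t"
    using \<open>0 < m\<close> den by (simp add: t_def)
  have t_den: "t * (B^4 + m\<^sup>2 + 1) = m"
    using den by (simp add: t_def)
  have "t * B^4 \<le> m"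
    using \<open>0 < t\<close> mult_left_mono[of "B^4" "B^4 + m\<^sup>2 + 1" t] t_den by simp
  have "t * m \<le> 1"
    using den by (simp add: t_def power2_eq_square)
  then have q: "0 \<le> q" "q < 1"
    using \<open>0 < t\<close> \<open>0 < m\<close> by (simp_all add: q_def)
  have contr: "(norm (u + t *\<^sub>R (- ?S u)))\<^sup>2 \<le> q * (norm u)\<^sup>2" for u
  proof -
    have Re_eq: "Re (cinner u (t *\<^sub>R (- ?S u))) = - t * (l2_norm (analysis g u))\<^sup>2"
    proof -
      have "Re (cinner u (t *\<^sub>R (- ?S u))) = Re (cinner ((- t) *\<^sub>R ?S u) u)"
        by (simp add: Re_cinner_commute[of u])
      also have "\<dots> = - t * Re (cinner (?S u) u)"
        unfolding scaleR_eq_scaleC cinner_scaleC_left by simp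
      finally show ?thesis
        by (simp add: Re_cinner_frame_operator[OF g])
    qed
    have "(norm (t *\<^sub>R (- ?S u)))\<^sup>2 \<le> (t * (B\<^sup>2 * norm u))\<^sup>2"
      using norm_frame_operator_le[OF g, of u] \<open>0 < t\<close> by (intro power_mono) simp_all
    also have "\<dots> = t * (t * B^4) * (norm u)\<^sup>2"
      by (simp add: power2_eq_square power4_eq_xxxx)
    also have "\<dots> \<le> t * m * (norm u)\<^sup>2"
      using \<open>t * B^4 \<le> m\<close> \<open>0 < t\<close> by (intro mult_right_mono mult_left_mono) simp_all
    finally have quadratic: "(norm (t *\<^sub>R (- ?S u)))\<^sup>2 \<le> t * m * (norm u)\<^sup>2" .
    have "t * (m * (norm u)\<^sup>2) \<le> t * (l2_norm (analysis g u))\<^sup>2"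
      using lower[of u] \<open>0 < t\<close> by simp
    then show ?thesis
      unfolding norm_add_square Re_eq using quadratic by (simp add: q_def algebra_simps)
  qed
  have "dist (h + t *\<^sub>R (y - ?S h)) (k + t *\<^sub>R (y - ?S k)) \<le> sqrt q * dist h k" for h k
  proof -
    have eq: "(h + t *\<^sub>R (y - ?S h)) - (k + t *\<^sub>R (y - ?S k)) = (h - k) + t *\<^sub>R (- ?S (h - k))"
      by (simp add: frame_operator_diff[OF g] algebra_simps)
    have "norm ((h - k) + t *\<^sub>R (- ?S (h - k))) \<le> sqrt (q * (norm (h - k))\<^sup>2)"
      by (rule real_le_rsqrt[OF contr])
    then show ?thesis
      unfolding dist_norm eq by (simp add: real_sqrt_mult)
  qed
  then have "\<exists>!h. h + t *\<^sub>R (y - ?S h) = h"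
    using banach_fix_type[of "sqrt q" "\<lambda>h. h + t *\<^sub>R (y - ?S h)"] q by simp
  moreover have "h + t *\<^sub>R (y - ?S h) = h \<longleftrightarrow> ?S h = y" for h
    using \<open>0 < t\<close> by auto
  ultimately show ?thesis
    by simp
qed

text \<open>This is the operator \<open>(T\<^sup>* T)\<^sup>-\<^sup>1 T\<^sup>*\<close>, that is, synthesis with the canonical dual frame.\<close>
definition dual_reconstruction :: "(nat \<Rightarrow> 'a::complex_inner) \<Rightarrow> (nat \<Rightarrow> complex) \<Rightarrow> 'a"
  where "dual_reconstruction g c = (THE h. frame_operator g h = synthesis g c)"

lemma dual_reconstruction:
  fixes g :: "nat \<Rightarrow> 'a::complex_hilbert_space"
  assumes g: "bessel_bound g B" and m: "0 < m"
    and lower: "\<And>h. m * (norm h)\<^sup>2 \<le> (l2_norm (analysis g h))\<^sup>2"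
  shows dual_reconstruction_analysis: "dual_reconstruction g (analysis g h) = h"
    and dual_reconstruction_add: "\<lbrakk>square_summable c; square_summable d\<rbrakk> \<Longrightarrow>
      dual_reconstruction g (\<lambda>j. c j + d j) = dual_reconstruction g c + dual_reconstruction g d"
    and dual_reconstruction_scale: "square_summable c \<Longrightarrow>
      dual_reconstruction g (\<lambda>j. a * c j) = a *\<^sub>C dual_reconstruction g c"
    and norm_dual_reconstruction_le: "square_summable c \<Longrightarrow>
      norm (dual_reconstruction g c) \<le> B / m * l2_norm c"
proof -
  note ex1 = ex1_frame_operator_eq[OF assms]
  have eq: "frame_operator g (dual_reconstruction g c) = synthesis g c" for c
    unfolding dual_reconstruction_def by (rule theI'[OF ex1])
  have unique: "dual_reconstruction g c = h" if "frame_operator g h = synthesis g c" for c h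
    unfolding dual_reconstruction_def using that by (rule the1_equality[OF ex1])
  show "dual_reconstruction g (analysis g h) = h"
    by (rule unique) (simp add: frame_operator_def)
  show "dual_reconstruction g (\<lambda>j. c j + d j) = dual_reconstruction g c + dual_reconstruction g d"
    if "square_summable c" "square_summable d"
    using that by (intro unique) (simp add: frame_operator_add[OF g] eq synthesis_add[OF g])
  show "dual_reconstruction g (\<lambda>j. a * c j) = a *\<^sub>C dual_reconstruction g c"
    if "square_summable c"
    using that by (intro unique) (simp add: frame_operator_scaleC[OF g] eq synthesis_scale[OF g])
  show "norm (dual_reconstruction g c) \<le> B / m * l2_norm c" if c: "square_summable c"
  proof -
    have "norm (dual_reconstruction g c) \<le> norm (synthesis g c) / m"
      by (rule frame_operator_eq_imp_norm_le[OF assms eq])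
    also have "\<dots> \<le> B * l2_norm c / m"
      using norm_synthesis_le[OF g c] m by (intro divide_right_mono) simp_all
    finally show ?thesis
      by simp
  qed
qed

section \<open>A frame allows stable recovery from two time steps\<close>

lemma frame_imp_stably_recoverable:
  fixes A :: "'a::complex_hilbert_space \<Rightarrow> 'a"
  assumes A: "bounded_clinear A" and g: "bessel_bound g B" and "is_frame g"
  shows "stably_recoverable A g 2"
proof -
  obtain m where m: "0 < m"
    and "\<And>h. m * (norm h)\<^sup>2 \<le> (\<Sum>j. (cmod (cinner h (g j)))\<^sup>2)"
    using \<open>is_frame g\<close> unfolding is_frame_def by blast
  then have lower: "m * (norm h)\<^sup>2 \<le> (l2_norm (analysis g h))\<^sup>2" for h
    using g by (subst l2_norm_square) (auto simp: bessel_bound_def analysis_def)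
  let ?L = "dual_reconstruction g"
  note L = dual_reconstruction[OF g m lower]
  have blA: "bounded_linear A" and scA: "\<And>a x. A (a *\<^sub>C x) = a *\<^sub>C A x"
    using A by (auto simp: bounded_clinear_def)
  interpret A: bounded_linear A by (rule blA)
  obtain MA where MA: "0 \<le> MA" "\<And>x. norm (A x) \<le> norm x * MA"
    using A.nonneg_bounded by blast
  define K where "K = B / m"
  have K: "0 \<le> K"
    using g m by (simp add: K_def bessel_bound_def)
  note L_le = L(4)[folded K_def]
  define R where "R D = ?L (D 1) - A (?L (D 0))" for D :: "nat \<Rightarrow> nat \<Rightarrow> complex"
  have rows: "square_summable (D 0)" "square_summable (D 1)" if "D \<in> l2_matrices 2" for D
    using that by (auto simp: l2_matrices_def square_summable_def)
  have "R (\<lambda>n j. D n j + E n j) = R D + R E" if "D \<in> l2_matrices 2" "E \<in> l2_matrices 2" for D E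
    using rows[OF that(1)] rows[OF that(2)] by (simp add: R_def L(2) A.add)
  moreover have "R (\<lambda>n j. a * D n j) = a *\<^sub>C R D" if "D \<in> l2_matrices 2" for a D
    using rows[OF that]
    by (simp add: R_def L(3) scA
          linear_diff[OF bounded_linear.linear[OF bounded_linear_scaleC_right]])
  moreover have "norm (R D) \<le> (K * (1 + MA)) * l2_matrix_norm 2 D"
    if "D \<in> l2_matrices 2" for D
  proof -
    note D = rows[OF that]
    have "norm (R D) \<le> norm (?L (D 1)) + norm (A (?L (D 0)))"
      unfolding R_def by (rule norm_triangle_ineq4)
    also have "\<dots> \<le> K * l2_norm (D 1) + (K * l2_norm (D 0)) * MA"
      using MA L_le[OF D(1)] L_le[OF D(2)]
      by (intro add_mono order_trans[OF MA(2)] mult_right_mono)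
    also have "\<dots> \<le> (K * (1 + MA)) * (l2_norm (D 0) + l2_norm (D 1))"
    proof -
      have "0 \<le> K * l2_norm (D 0)" "0 \<le> K * l2_norm (D 1) * MA"
        using K MA l2_norm_nonneg[OF D(1)] l2_norm_nonneg[OF D(2)] by simp_all
      then show ?thesis
        by (simp add: algebra_simps)
    qed
    also have "l2_norm (D 0) + l2_norm (D 1) = l2_matrix_norm 2 D"
      by (simp add: l2_matrix_norm_def l2_norm_def numeral_2_eq_2)
    finally show ?thesis .
  qed
  ultimately have "bounded_clinear_on_l2_matrices 2 R"
    unfolding bounded_clinear_on_l2_matrices_def by blast
  moreover have "R (measurements A g 2 x0 w) = w" for x0 w
  proof -
    have "measurements A g 2 x0 w 0 = analysis g x0"
      and "measurements A g 2 x0 w 1 = analysis g (A x0 + w)"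
      by (simp_all add: measurements_def analysis_def)
    then show ?thesis
      by (simp add: R_def L(1))
  qed
  ultimately show ?thesis
    unfolding stably_recoverable_def by blast
qed

section \<open>Stable recovery forces the lower frame bound\<close>

text \<open>The deviation \<open>e\<^sub>n = x\<^sub>n - n h\<close> obeys \<open>e\<^sub>n\<^sub>+\<^sub>1 = A e\<^sub>n - n (h - A h)\<close>, so it is driven by the failure
  of \<open>h\<close> to be fixed by \<open>A\<close>.\<close>
lemma orbit_zero_near_multiple:
  assumes "bounded_linear A"
  shows "\<exists>M\<ge>0. \<forall>h. norm (orbit A 0 h n - real n *\<^sub>R h) \<le> M * norm (h - A h)"
proof (induction n)
  case 0
  show ?case
    by (auto intro: exI[of _ 0])
next
  case (Suc n)
  interpret A: bounded_linear A by (rule assms)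
  obtain MA where MA: "0 \<le> MA" "\<And>x. norm (A x) \<le> norm x * MA"
    using A.nonneg_bounded by blast
  obtain M where M: "0 \<le> M" "\<And>h. norm (orbit A 0 h n - real n *\<^sub>R h) \<le> M * norm (h - A h)"
    using Suc.IH by blast
  have "norm (orbit A 0 h (Suc n) - real (Suc n) *\<^sub>R h) \<le> (M * MA + real n) * norm (h - A h)" for h
  proof -
    have "orbit A 0 h (Suc n) - real (Suc n) *\<^sub>R h
        = A (orbit A 0 h n - real n *\<^sub>R h) - real n *\<^sub>R (h - A h)"
      by (simp add: A.diff A.scaleR algebra_simps)
    also have "norm \<dots> \<le> norm (A (orbit A 0 h n - real n *\<^sub>R h)) + norm (real n *\<^sub>R (h - A h))"
      by (rule norm_triangle_ineq4)
    also have "\<dots> \<le> M * norm (h - A h) * MA + real n * norm (h - A h)"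
      using MA M by (intro add_mono order_trans[OF MA(2)] mult_right_mono) simp_all
    finally show ?thesis
      by (simp add: algebra_simps)
  qed
  then show ?case
    using M MA by (intro exI[of _ "M * MA + real n"]) simp
qed

lemma orbit_fixed: "orbit A h (h - A h) n = h"
  by (induction n) simp_all

text \<open>Recovery is tested on the frozen orbit (\<open>nearly_fixed\<close>) and then on the orbit of the zero state;
  the first test turns the deviation in the second into a multiple of \<open>\<parallel>T h\<parallel>\<close>.\<close>
lemma stably_recoverable_imp_lower_bound:
  fixes A :: "'a::complex_hilbert_space \<Rightarrow> 'a"
  assumes A: "bounded_linear A" and g: "bessel_bound g B" and rec: "stably_recoverable A g N"
  obtains M where "\<And>h. norm h \<le> M * l2_norm (analysis g h)"
proof -
  let ?t = "\<lambda>h. l2_norm (analysis g h)"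
  have ss: "square_summable (analysis g h)" and le_B: "?t h \<le> B * norm h" for h
    using g by (auto simp: bessel_bound_def)
  have B: "0 \<le> B"
    using g by (simp add: bessel_bound_def)
  have t_nonneg: "0 \<le> ?t h" for h
    by (rule l2_norm_nonneg[OF ss])
  obtain R K where R: "\<And>x0 w. R (measurements A g N x0 w) = w"
    and K: "\<And>D. D \<in> l2_matrices N \<Longrightarrow> norm (R D) \<le> K * l2_matrix_norm N D"
    using rec unfolding stably_recoverable_def bounded_clinear_on_l2_matrices_def by blast
  have observed: "norm w \<le> \<bar>K\<bar> * (\<Sum>n<N. ?t (orbit A x0 w n))" for x0 w
  proof -
    have "measurements A g N x0 w \<in> l2_matrices N"
      using ss by (simp add: l2_matrices_def measurements_def square_summable_def analysis_def)
    then have "norm w \<le> K * l2_matrix_norm N (measurements A g N x0 w)"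
      using K R by metis
    also have "l2_matrix_norm N (measurements A g N x0 w) = (\<Sum>n<N. ?t (orbit A x0 w n))"
      unfolding l2_matrix_norm_def
      by (intro sum.cong) (simp_all add: l2_norm_def measurements_def analysis_def)
    also have "K * \<dots> \<le> \<bar>K\<bar> * \<dots>"
      by (intro mult_right_mono) (simp_all add: sum_nonneg t_nonneg)
    finally show ?thesis .
  qed
  have nearly_fixed: "norm (h - A h) \<le> \<bar>K\<bar> * real N * ?t h" for h
    using observed[of "h - A h" h] by (simp add: orbit_fixed)
  have "\<exists>M. \<forall>h. ?t (orbit A 0 h n) \<le> M * ?t h" for n
  proof -
    obtain M where M: "0 \<le> M" "\<And>h. norm (orbit A 0 h n - real n *\<^sub>R h) \<le> M * norm (h - A h)"
      using orbit_zero_near_multiple[OF A, of n] by blast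
    have "?t (orbit A 0 h n) \<le> (B * (M * (\<bar>K\<bar> * real N)) + real n) * ?t h" for h
    proof -
      let ?d = "orbit A 0 h n - real n *\<^sub>R h"
      have "analysis g (orbit A 0 h n)
          = (\<lambda>j. analysis g ?d j + complex_of_real (real n) * analysis g h j)"
        using analysis_add[of g ?d "real n *\<^sub>R h"]
        by (simp only: scaleR_eq_scaleC analysis_scaleC diff_add_cancel)
      then have "?t (orbit A 0 h n) \<le> ?t ?d + real n * ?t h"
        using l2_add(2)[OF ss[of ?d] l2_scale(1)[OF ss[of h], of "complex_of_real (real n)"]]
        by (simp add: l2_scale(2)[OF ss])
      moreover have "?t ?d \<le> B * (M * (\<bar>K\<bar> * real N * ?t h))"
        using le_B[of ?d] M(2)[of h] nearly_fixed[of h] M(1) B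
        by (meson order_trans mult_left_mono)
      ultimately show ?thesis
        by (simp add: algebra_simps)
    qed
    then show ?thesis
      by blast
  qed
  then obtain M where M: "\<And>n h. ?t (orbit A 0 h n) \<le> M n * ?t h"
    by metis
  have "norm h \<le> (\<bar>K\<bar> * (\<Sum>n<N. M n)) * ?t h" for h
  proof -
    have "norm h \<le> \<bar>K\<bar> * (\<Sum>n<N. ?t (orbit A 0 h n))"
      by (rule observed)
    also have "\<dots> \<le> \<bar>K\<bar> * (\<Sum>n<N. M n * ?t h)"
      by (intro mult_left_mono sum_mono M) simp
    finally show ?thesis
      by (simp add: sum_distrib_right mult.assoc)
  qed
  then show thesis
    by (rule that)
qed

lemma lower_bound_imp_is_frame:
  assumes g: "bessel_bound g B" and lower: "\<And>h. norm h \<le> M * l2_norm (analysis g h)"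
  shows "is_frame g"
proof -
  have ss: "square_summable (analysis g h)" and le_B: "l2_norm (analysis g h) \<le> B * norm h" for h
    using g by (auto simp: bessel_bound_def)
  \<comment> \<open>The summands \<open>1\<close> make the constants positive and ordered, also in the zero space.\<close>
  define c where "c = 1 / (M\<^sup>2 + 1)"
  have den: "0 < M\<^sup>2 + 1"
    by (simp add: add_nonneg_pos)
  then have "0 < c" "c \<le> 1"
    by (simp_all add: c_def)
  moreover have "1 \<le> B\<^sup>2 + 1"
    by simp
  ultimately have "0 < c" "c \<le> B\<^sup>2 + 1"
    by linarith+
  moreover have "c * (norm h)\<^sup>2 \<le> (l2_norm (analysis g h))\<^sup>2" for h
  proof -
    have "(norm h)\<^sup>2 \<le> (M * l2_norm (analysis g h))\<^sup>2"
      using lower[of h] by (intro power_mono) simp_all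
    also have "\<dots> \<le> (M\<^sup>2 + 1) * (l2_norm (analysis g h))\<^sup>2"
      by (simp add: power_mult_distrib algebra_simps)
    finally show ?thesis
      using den by (simp add: c_def divide_le_eq mult.commute)
  qed
  moreover have "(l2_norm (analysis g h))\<^sup>2 \<le> (B\<^sup>2 + 1) * (norm h)\<^sup>2" for h
  proof -
    have "(l2_norm (analysis g h))\<^sup>2 \<le> (B * norm h)\<^sup>2"
      using le_B[of h] l2_norm_nonneg[OF ss] by (intro power_mono)
    also have "\<dots> \<le> (B\<^sup>2 + 1) * (norm h)\<^sup>2"
      by (simp add: power_mult_distrib algebra_simps)
    finally show ?thesis .
  qed
  moreover have "summable (\<lambda>j. (cmod (cinner h (g j)))\<^sup>2)"
    and "(\<Sum>j. (cmod (cinner h (g j)))\<^sup>2) = (l2_norm (analysis g h))\<^sup>2" for h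
    using ss[of h] l2_norm_square[OF ss[of h]] by (simp_all add: square_summable_def analysis_def)
  ultimately show ?thesis
    unfolding is_frame_def by (intro exI[of _ c] exI[of _ "B\<^sup>2 + 1"]) simp
qed

theorem theorem3p2:
  fixes A :: "'a::complex_hilbert_space \<Rightarrow> 'a" and g :: "nat \<Rightarrow> 'a"
  assumes "separable_space (euclidean :: 'a topology)"
    and "bounded_clinear A"
    and "bessel_sequence g"
  shows "(\<exists>N\<ge>1. stably_recoverable A g N) \<longleftrightarrow> is_frame g"
proof -
  obtain B where g: "bessel_bound g B"
    using bessel_sequence_imp_bessel_bound[OF \<open>bessel_sequence g\<close>] .
  have A: "bounded_linear A"
    using \<open>bounded_clinear A\<close> by (simp add: bounded_clinear_def)
  show ?thesis
  proof
    assume "\<exists>N\<ge>1. stably_recoverable A g N"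
    then obtain N where "stably_recoverable A g N"
      by blast
    then show "is_frame g"
      using stably_recoverable_imp_lower_bound[OF A g] lower_bound_imp_is_frame[OF g] by metis
  next
    assume "is_frame g"
    then have "stably_recoverable A g 2"
      by (rule frame_imp_stably_recoverable[OF \<open>bounded_clinear A\<close> g])
    then show "\<exists>N\<ge>1. stably_recoverable A g N"
      by (intro exI[of _ 2]) simp
  qed
qed

end
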